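(* Let $n>m\ge 1$ be co-prime integers. Let $p,q:[0,\infty)\to\mathbb{R}$ be two right analytic functions of exponential order with $\inf\{x>0: p(x)\neq 0\}=0$ and $\inf\{x>0: q(x)\neq 0\}=0$, and with $p(0)=0$. Suppose that one of the following conditions holds: (1) $n$ is odd, $m$ is even, and $p(t)\neq 0$ for all $t>0$; (2) $n$ is odd, $m$ is odd, $p(t)\neq 0$ for all $t>0$, and $\inf\{t: p(t)q(t)>0\}=0$; (3) $n$ is even, and $p(t)q(t)>0$ for all $t>0$. If $H_{n,m}(p,\cdot)=H_{n,m}(q,\cdot)$, then $p=q$, i.e. $p(x)=q(x)$ for all $x\ge 0$.
   Context: A function $p:[0,\infty)\to\mathbb{R}$ is of exponential order if there exist $c>0$, $C>0$ with $|p(x)|\le Ce^{cx}$ for all $x\ge 0$; its Laplace transform is $\widehat p(\lambda)=\int_0^\infty e^{-\lambda x}p(x)\,dx$ for $\lambda$ with real part larger than $c$. The function $p$ is right analytic (on $[0,\infty)$) if it is right analytic at every point $s\ge 0$: there are $\delta>0$ and reals $a_0,a_1,\dots$ such that $p(t)=\sum_{i\ge 0}a_i(t-s)^i$ for all $t\in[s,s+\delta)$. For positive integers $n,m$, $H_{n,m}(p,\lambda):=\widehat{p^n}(\lambda)/\widehat{p^m}(\lambda)$, where $p^k$ is the pointwise $k$-th power. The equality $H_{n,m}(p,\cdot)=H_{n,m}(q,\cdot)$ means $H_{n,m}(p,\lambda)=H_{n,m}(q,\lambda)$ for all sufficiently large $\lambda$. *)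

theory Defs
  imports "HOL-Analysis.Analysis"
begin

text \<open>A function on the half-line [0, \<infinity>) is represented by a function of type
  \<^typ>\<open>real \<Rightarrow> real\<close>; its values at negative arguments are never used.\<close>

definition exponential_order :: "(real \<Rightarrow> real) \<Rightarrow> bool" where
  "exponential_order p \<longleftrightarrow> (\<exists>c>0. \<exists>C>0. \<forall>x\<ge>0. \<bar>p x\<bar> \<le> C * exp (c * x))"

definition right_analytic_at :: "(real \<Rightarrow> real) \<Rightarrow> real \<Rightarrow> bool" where
  "right_analytic_at p s \<longleftrightarrow>
     (\<exists>\<delta>>0. \<exists>a :: nat \<Rightarrow> real. \<forall>t\<in>{s..<s + \<delta>}. (\<lambda>i. a i * (t - s) ^ i) sums p t)"

definition right_analytic :: "(real \<Rightarrow> real) \<Rightarrow> bool" where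
  "right_analytic p \<longleftrightarrow> (\<forall>s\<ge>0. right_analytic_at p s)"

text \<open>For non-integrable integrands the Bochner integral is 0, so \<open>laplace_transform p z\<close> is
  meaningful only when the real part of \<open>z\<close> is large enough.\<close>

definition laplace_transform :: "(real \<Rightarrow> real) \<Rightarrow> complex \<Rightarrow> complex" where
  "laplace_transform p z = (LINT x:{0..}|lborel. exp (- (z * of_real x)) * of_real (p x))"

definition H :: "nat \<Rightarrow> nat \<Rightarrow> (real \<Rightarrow> real) \<Rightarrow> complex \<Rightarrow> complex" where
  "H n m p z = laplace_transform (\<lambda>x. p x ^ n) z / laplace_transform (\<lambda>x. p x ^ m) z"

text \<open>The infimum is taken in \<^typ>\<open>ereal\<close>, where the infimum of the empty set is \<open>\<infinity>\<close>
  (in \<^typ>\<open>real\<close> it would be an unspecified number).\<close>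

definition inf_set :: "real set \<Rightarrow> ereal" where
  "inf_set A = Inf (ereal ` A)"

end

theory Submission
  imports Defs "HOL-Probability.Sinc_Integral"
begin

text \<open>
  Write \<open>L f\<close> for the Laplace transform at real arguments. Everything rests on the leading-term
  case of Watson's lemma (\<open>watson_leading_term\<close>): if \<open>f t / t ^ k\<close> tends to \<open>a\<close> as \<open>t\<close> decreases to
  \<open>0\<close>, then \<open>l ^ (k + 1) * L f l\<close> tends to \<open>a * k!\<close> as \<open>l\<close> grows. Hence in an identity between
  products of two Laplace transforms the orders at \<open>0\<close> and the leading coefficients on the two
  sides can be compared (\<open>laplace_product_identity\<close>).

  The hypothesis says \<open>L (p ^ n) * L (q ^ m) = L (q ^ n) * L (p ^ m)\<close> for large arguments. With
  \<open>p t \<sim> a * t ^ k\<close> and \<open>q t \<sim> b * t ^ j\<close>, comparing orders and coefficients gives \<open>k = j\<close> and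
  \<open>a ^ (n - m) = b ^ (n - m)\<close>, and the parity and sign conditions turn this into \<open>a = b\<close>. Since
  \<open>p 0 = 0\<close>, the common order \<open>k\<close> is positive.

  Suppose now that \<open>p\<close> and \<open>q\<close> agree on \<open>[0, s)\<close>, and let \<open>P x = p (s + x)\<close>, \<open>Q x = q (s + x)\<close>. The
  differences \<open>p ^ i - q ^ i\<close> vanish up to \<open>s\<close>, so a common exponential factor cancels and
  \<open>L (P ^ n - Q ^ n) * L (q ^ m) = L (P ^ m - Q ^ m) * L (q ^ n)\<close> (\<open>laplace_identity_after_agreement\<close>).
  Suppose also that \<open>P - Q\<close> does not vanish near \<open>0\<close>, say \<open>P t - Q t \<sim> c * t ^ l\<close> with
  \<open>c \<noteq> 0\<close>.

  \<^item> If \<open>s > 0\<close> (\<open>agreement_continues\<close>), then \<open>P ^ n - Q ^ n\<close> has order exactly \<open>l\<close>, because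
    \<open>P 0 \<noteq> 0\<close> and equal \<open>n\<close>-th powers force \<open>P 0 = Q 0\<close>; and \<open>P ^ m - Q ^ m\<close> has order at least
    \<open>l\<close>. The two sides of the identity have orders \<open>l + k * m\<close> and at least \<open>l + k * n\<close>, which is
    larger as \<open>k > 0\<close>.

  \<^item> If \<open>s = 0\<close> (\<open>agreement_at_0\<close>), then \<open>l \<ge> k\<close> because the leading terms of \<open>p\<close> and \<open>q\<close> are
    equal. The orders of the two sides coincide, and with \<open>l = k + d\<close> the coefficients give
    \<open>n * (k * n + d)! / (k * n)! = m * (k * m + d)! / (k * m)!\<close>. The quotient
    \<open>(N + d)! / N!\<close> does not decrease as \<open>N\<close> grows, so the left-hand side is larger.

  Both are contradictions. So agreement on \<open>[0, s)\<close> always extends beyond \<open>s\<close>, and there is no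
  first point of disagreement (\<open>agreement_everywhere\<close>). Right analytic functions may jump, so
  agreement at \<open>s\<close> itself is not inherited from the left and is part of what each step proves.
\<close>

section \<open>Real Laplace transforms of functions of exponential order\<close>

definition real_laplace :: "(real \<Rightarrow> real) \<Rightarrow> real \<Rightarrow> real" where
  "real_laplace f l = (LINT x:{0..}|lborel. exp (- (l * x)) * f x)"

definition transformable :: "(real \<Rightarrow> real) \<Rightarrow> bool" where
  "transformable f \<longleftrightarrow> exponential_order f \<and> set_borel_measurable borel {0..} f"

lemma laplace_transform_of_real:
  "laplace_transform f (of_real l) = of_real (real_laplace f l)"
proof -
  have "laplace_transform f (of_real l)
      = (LINT x:{0..}|lborel. complex_of_real (exp (- (l * x)) * f x))"
    unfolding laplace_transform_def by (simp add: exp_of_real flip: of_real_mult of_real_minus)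
  then show ?thesis
    unfolding real_laplace_def by (simp only: set_integral_complex_of_real)
qed

lemma exponential_orderI:
  assumes "\<And>x. x \<ge> 0 \<Longrightarrow> \<bar>f x\<bar> \<le> C * exp (c * x)"
  shows "exponential_order f"
  unfolding exponential_order_def
proof (intro exI conjI allI impI)
  fix x :: real assume x: "x \<ge> 0"
  have "C * exp (c * x) \<le> (\<bar>C\<bar> + 1) * exp ((\<bar>c\<bar> + 1) * x)"
    using x by (intro mult_mono) (auto intro: mult_right_mono)
  then show "\<bar>f x\<bar> \<le> (\<bar>C\<bar> + 1) * exp ((\<bar>c\<bar> + 1) * x)"
    using assms[OF x] by linarith
qed auto

lemma exponential_orderE:
  assumes "exponential_order f"
  obtains c C where "c > 0" "C > 0" "\<And>x. x \<ge> 0 \<Longrightarrow> \<bar>f x\<bar> \<le> C * exp (c * x)"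
  using assms unfolding exponential_order_def by auto

lemma exponential_order_power:
  assumes "exponential_order f"
  shows "exponential_order (\<lambda>x. f x ^ k)"
proof -
  obtain c C where *: "c > 0" "C > 0" "\<And>x. x \<ge> 0 \<Longrightarrow> \<bar>f x\<bar> \<le> C * exp (c * x)"
    using assms by (rule exponential_orderE) blast
  show ?thesis
  proof (rule exponential_orderI)
    fix x :: real assume "x \<ge> 0"
    then have "\<bar>f x\<bar> ^ k \<le> (C * exp (c * x)) ^ k"
      using * by (intro power_mono) auto
    also have "\<dots> = C ^ k * exp (real k * c * x)"
      by (simp add: power_mult_distrib mult.assoc flip: exp_of_nat_mult)
    finally show "\<bar>f x ^ k\<bar> \<le> C ^ k * exp (real k * c * x)"
      by (simp add: power_abs)
  qed
qed

lemma exponential_order_diff: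
  assumes "exponential_order f" "exponential_order g"
  shows "exponential_order (\<lambda>x. f x - g x)"
proof -
  obtain c C where f: "c > 0" "C > 0" "\<And>x. x \<ge> 0 \<Longrightarrow> \<bar>f x\<bar> \<le> C * exp (c * x)"
    using assms(1) by (rule exponential_orderE) blast
  obtain d D where g: "d > 0" "D > 0" "\<And>x. x \<ge> 0 \<Longrightarrow> \<bar>g x\<bar> \<le> D * exp (d * x)"
    using assms(2) by (rule exponential_orderE) blast
  show ?thesis
  proof (rule exponential_orderI)
    fix x :: real assume x: "x \<ge> 0"
    have "C * exp (c * x) \<le> C * exp (max c d * x)" "D * exp (d * x) \<le> D * exp (max c d * x)"
      using f g x by (auto intro!: mult_right_mono)
    then show "\<bar>f x - g x\<bar> \<le> (C + D) * exp (max c d * x)"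
      using f(3)[OF x] g(3)[OF x] by (simp add: distrib_right)
  qed
qed

lemma exponential_order_shift:
  assumes "exponential_order f" "s \<ge> 0"
  shows "exponential_order (\<lambda>x. f (s + x))"
proof -
  obtain c C where f: "c > 0" "C > 0" "\<And>x. x \<ge> 0 \<Longrightarrow> \<bar>f x\<bar> \<le> C * exp (c * x)"
    using assms(1) by (rule exponential_orderE) blast
  show ?thesis
    by (rule exponential_orderI[of _ "C * exp (c * s)" c])
       (use f(3)[of "s + _"] assms(2) in \<open>auto simp: algebra_simps exp_add\<close>)
qed

lemma transformable_power: "transformable f \<Longrightarrow> transformable (\<lambda>x. f x ^ k)"
proof -
  assume f: "transformable f"
  have eq: "(\<lambda>x. indicator {0..} x *\<^sub>R f x ^ k)
      = (\<lambda>x. indicator {0..} x * (indicator {0..} x *\<^sub>R f x) ^ k)"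
    by (auto simp: indicator_def fun_eq_iff)
  show ?thesis
    using f unfolding transformable_def set_borel_measurable_def eq
    by (auto intro: exponential_order_power)
qed

lemma transformable_diff:
  "transformable f \<Longrightarrow> transformable g \<Longrightarrow> transformable (\<lambda>x. f x - g x)"
  unfolding transformable_def set_borel_measurable_def
  by (auto intro: exponential_order_diff simp: right_diff_distrib)

lemma transformable_shift:
  assumes f: "transformable f" and s: "s \<ge> 0"
  shows "transformable (\<lambda>x. f (s + x))"
proof -
  have eq: "(\<lambda>x. indicator {0..} x *\<^sub>R f (s + x))
      = (\<lambda>x. indicator {0..} x * (indicator {0..} (s + x) *\<^sub>R f (s + x)))"
    using s by (auto simp: indicator_def fun_eq_iff)
  have "(\<lambda>x. indicator {0..} x *\<^sub>R f x) \<in> borel_measurable borel"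
    using f unfolding transformable_def set_borel_measurable_def by simp
  then have "(\<lambda>x. indicator {0..} (s + x) *\<^sub>R f (s + x)) \<in> borel_measurable borel"
    by (rule measurable_compose_rev) simp
  then show ?thesis
    using f s unfolding transformable_def set_borel_measurable_def eq
    by (auto intro: exponential_order_shift)
qed

text \<open>A dominating function for Watson's lemma: half of the decay of \<open>exp (- x)\<close> is given up to
  absorb the exponential growth of the transformed function.\<close>

lemma integrable_power_exp_half:
  "integrable lborel (\<lambda>x::real. indicator {0..} x * (x ^ k * exp (- (x / 2))))"
proof -
  have "integrable lborel (\<lambda>x::real. x ^ k * exp (- x) * indicator {0..} x)"
    using has_bochner_integral_I0i_power_exp_m'[of k] by (simp add: has_bochner_integral_iff)
  from lborel_integrable_real_affine[OF this, of "1/2" 0]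
  have "integrable lborel (\<lambda>x::real. 2 ^ k * ((x/2) ^ k * exp (- (x/2)) * indicator {0..} (x/2)))"
    by (intro integrable_mult_right) simp
  also have "(\<lambda>x::real. 2 ^ k * ((x/2) ^ k * exp (- (x/2)) * indicator {0..} (x/2)))
      = (\<lambda>x. indicator {0..} x * (x ^ k * exp (- (x / 2))))"
    by (auto simp: fun_eq_iff indicator_def power_divide)
  finally show ?thesis .
qed

lemma eventually_integrable_laplace:
  assumes "transformable f"
  shows "\<forall>\<^sub>F l in at_top. set_integrable lborel {0..} (\<lambda>x. exp (- (l * x)) * f x)"
proof -
  obtain c C where f: "c > 0" "C > 0" "\<And>x. x \<ge> 0 \<Longrightarrow> \<bar>f x\<bar> \<le> C * exp (c * x)"
    using assms unfolding transformable_def by (auto elim: exponential_orderE)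
  have [measurable]: "(\<lambda>x. indicator {0..} x *\<^sub>R f x) \<in> borel_measurable borel"
    using assms unfolding transformable_def set_borel_measurable_def by simp
  have eq: "(\<lambda>x. indicator {0..} x *\<^sub>R (exp (- (l * x)) * f x))
     = (\<lambda>x. exp (- (l * x)) * (indicator {0..} x *\<^sub>R f x))" for l
    by (auto simp: fun_eq_iff)
  show ?thesis
    using eventually_ge_at_top[of "c + 1"]
  proof eventually_elim
    case (elim l)
    have int: "integrable lborel (\<lambda>x::real. C * (indicator {0..} x * (x ^ 0 * exp (- (x / 2)))))"
      by (intro integrable_mult_right integrable_power_exp_half)
    have "norm (indicator {0..} x *\<^sub>R (exp (- (l * x)) * f x))
        \<le> norm (C * (indicator {0..} x * (x ^ 0 * exp (- (x / 2)))))" for x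
    proof (cases "x \<ge> 0")
      case True
      have "c * x + x \<le> l * x"
        using elim True mult_right_mono[of "c + 1" l x] by (simp add: distrib_right)
      then have "exp (- (l * x)) * (C * exp (c * x)) \<le> C * exp (- (x / 2))"
        using f True by (simp flip: exp_add)
      then have "exp (- (l * x)) * \<bar>f x\<bar> \<le> C * exp (- (x / 2))"
        using mult_left_mono[OF f(3)[OF True], of "exp (- (l * x))"] by (meson exp_ge_zero order_trans)
      then show ?thesis
        using True f(2) by (simp add: abs_mult)
    qed simp
    moreover have "(\<lambda>x. indicator {0..} x *\<^sub>R (exp (- (l * x)) * f x)) \<in> borel_measurable lborel"
      unfolding eq by measurable
    ultimately show ?case
      unfolding set_integrable_def
      by (intro Bochner_Integration.integrable_bound[OF int]) auto
  qed
qed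

text \<open>Additivity needs both transforms to converge absolutely, which exponential order guarantees
  only for large arguments.\<close>

lemma eventually_real_laplace_diff:
  assumes "transformable f" "transformable g"
  shows "\<forall>\<^sub>F l in at_top. real_laplace (\<lambda>x. f x - g x) l = real_laplace f l - real_laplace g l"
  using eventually_integrable_laplace[OF assms(1)] eventually_integrable_laplace[OF assms(2)]
  unfolding real_laplace_def
  by eventually_elim (simp add: right_diff_distrib set_integral_diff)

lemma real_laplace_shift:
  assumes "s \<ge> 0" "\<And>x. 0 \<le> x \<Longrightarrow> x < s \<Longrightarrow> f x = 0"
  shows "real_laplace f l = exp (- (l * s)) * real_laplace (\<lambda>x. f (s + x)) l"
proof -
  have "real_laplace f l
      = (\<integral>x. indicator {0..} (s + 1 * x) *\<^sub>R (exp (- (l * (s + 1 * x))) * f (s + 1 * x)) \<partial>lborel)"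
    unfolding real_laplace_def set_lebesgue_integral_def
    by (subst lborel_integral_real_affine[where c = 1 and t = s]) auto
  also have "\<dots> = (\<integral>x. exp (- (l * s)) * (indicator {0..} x *\<^sub>R (exp (- (l * x)) * f (s + x))) \<partial>lborel)"
    using assms
    by (intro Bochner_Integration.integral_cong)
       (auto simp: indicator_def algebra_simps exp_diff exp_minus field_simps)
  finally show ?thesis
    unfolding real_laplace_def set_lebesgue_integral_def by simp
qed

section \<open>Watson's lemma for the leading term\<close>

text \<open>The coefficient \<open>a\<close> may be \<open>0\<close>; then the order of \<open>f\<close> at \<open>0\<close> is only bounded below. This lets
  the powers and differences of functions be handled before it is known whether terms cancel.\<close>

definition leading_term :: "(real \<Rightarrow> real) \<Rightarrow> nat \<Rightarrow> real \<Rightarrow> bool" where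
  "leading_term f k a \<longleftrightarrow> ((\<lambda>t. f t / t ^ k) \<longlongrightarrow> a) (at_right 0)"

text \<open>Dominated convergence needs control on the whole half-line. Near \<open>0\<close> the limit supplies the
  factor \<open>t ^ k\<close>; beyond some \<open>d > 0\<close> that factor is at least \<open>d ^ k\<close> and costs only a constant.\<close>

lemma leading_term_imp_bound:
  assumes "exponential_order f" "leading_term f k a"
  obtains M c where "M > 0" "c > 0" "\<And>t. t > 0 \<Longrightarrow> \<bar>f t\<bar> \<le> M * t ^ k * exp (c * t)"
proof -
  obtain c C where f: "c > 0" "C > 0" "\<And>x. x \<ge> 0 \<Longrightarrow> \<bar>f x\<bar> \<le> C * exp (c * x)"
    using assms(1) by (auto elim: exponential_orderE)
  have "((\<lambda>t. \<bar>f t / t ^ k\<bar>) \<longlongrightarrow> \<bar>a\<bar>) (at_right 0)"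
    using assms(2) unfolding leading_term_def by (intro tendsto_intros)
  then have "\<forall>\<^sub>F t in at_right 0. \<bar>f t / t ^ k\<bar> < \<bar>a\<bar> + 1"
    by (rule order_tendstoD) simp
  then obtain d where d: "d > 0" "\<And>t. 0 < t \<Longrightarrow> t < d \<Longrightarrow> \<bar>f t / t ^ k\<bar> < \<bar>a\<bar> + 1"
    unfolding eventually_at_right_field by auto
  define M where "M = max (\<bar>a\<bar> + 1) (C / d ^ k)"
  have "\<bar>f t\<bar> \<le> M * t ^ k * exp (c * t)" if t: "t > 0" for t
  proof (cases "t < d")
    case True
    have "\<bar>f t\<bar> \<le> (\<bar>a\<bar> + 1) * t ^ k"
      using d(2)[OF t True] t by (simp add: abs_divide field_simps)
    also have "\<dots> \<le> M * t ^ k"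
      using t by (intro mult_right_mono) (auto simp: M_def)
    also have "\<dots> \<le> M * t ^ k * exp (c * t)"
      using t f(1) mult_left_mono[of 1 "exp (c * t)" "M * t ^ k"] by (auto simp: M_def)
    finally show ?thesis .
  next
    case False
    have "C = C / d ^ k * d ^ k"
      using d(1) by simp
    also have "\<dots> \<le> M * t ^ k"
      using d(1) f(2) False by (intro mult_mono power_mono) (auto simp: M_def)
    finally have "C * exp (c * t) \<le> M * t ^ k * exp (c * t)"
      by (rule mult_right_mono) simp
    then show ?thesis
      using f(3)[of t] t by (meson less_imp_le order_trans)
  qed
  moreover have "M > 0" by (simp add: M_def less_max_iff_disj add_nonneg_pos)
  ultimately show thesis using f(1) that by blast
qed

text \<open>Substituting \<open>x / l\<close> for the integration variable turns \<open>l ^ (k + 1) * real_laplace f l\<close> into the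
  integral of \<open>exp (- x) * x ^ k\<close> times the value of \<open>f t / t ^ k\<close> at \<open>t = x / l\<close>. That quotient tends to \<open>a\<close>, so
  dominated convergence leaves \<open>a\<close> times the Gamma integral for \<open>k!\<close>.\<close>

lemma watson_leading_term:
  assumes f: "transformable f" and lt: "leading_term f k a"
  shows "((\<lambda>l. l ^ (k + 1) * real_laplace f l) \<longlongrightarrow> a * fact k) at_top"
proof -
  obtain M c where M: "M > 0" "c > 0" "\<And>t. t > 0 \<Longrightarrow> \<bar>f t\<bar> \<le> M * t ^ k * exp (c * t)"
    using f lt unfolding transformable_def by (auto elim: leading_term_imp_bound)
  define g where "g = (\<lambda>x. indicator {0..} x *\<^sub>R f x)"
  have [measurable]: "g \<in> borel_measurable borel"
    using f unfolding transformable_def set_borel_measurable_def g_def by simp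
  define S where "S = (\<lambda>l x. l ^ k * (exp (- x) * g (x / l)))"
  define L where "L = (\<lambda>x. a * (x ^ k * exp (- x) * indicator {0..} x))"
  define w where "w = (\<lambda>x::real. M * (indicator {0..} x * (x ^ k * exp (- (x / 2)))))"
  have scale: "l ^ (k + 1) * real_laplace f l = (\<integral>x. S l x \<partial>lborel)" if "l > 0" for l
  proof -
    have "real_laplace f l = (\<integral>x. exp (- (l * x)) * g x \<partial>lborel)"
      unfolding real_laplace_def set_lebesgue_integral_def g_def
      by (intro Bochner_Integration.integral_cong) auto
    also have "\<dots> = 1 / l * (\<integral>x. exp (- x) * g (x / l) \<partial>lborel)"
      using that by (subst lborel_integral_real_affine[where c = "1 / l" and t = 0]) auto
    finally show ?thesis
      using that by (simp add: S_def)
  qed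
  have ae: "AE x::real in lborel. x \<noteq> 0"
    by (rule AE_lborel_singleton)
  have "((\<lambda>l. \<integral>x. S l x \<partial>lborel) \<longlongrightarrow> (\<integral>x. L x \<partial>lborel)) at_top"
  proof (rule integral_dominated_convergence_at_top)
    show "integrable lborel w"
      unfolding w_def by (intro integrable_mult_right integrable_power_exp_half)
    \<comment> \<open>For \<open>l \<ge> 2 * c\<close> the growth factor \<open>exp (c * x / l)\<close> is at most \<open>exp (x / 2)\<close>.\<close>
    show "\<forall>\<^sub>F l in at_top. AE x in lborel. norm (S l x) \<le> w x"
      using eventually_ge_at_top[of "2 * c"]
    proof eventually_elim
      case (elim l)
      then have l: "l > 0" using M by linarith
      show ?case
        using ae
      proof eventually_elim
        case (elim x)
        show ?case
        proof (cases "x > 0")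
          case True
          then have "\<bar>f (x / l)\<bar> \<le> M * (x / l) ^ k * exp (c * (x / l))"
            using l by (intro M) simp
          also have "\<dots> \<le> M * (x / l) ^ k * exp (x / 2)"
            using \<open>2 * c \<le> l\<close> l True M
            by (intro mult_left_mono) (auto simp: field_simps intro!: mult_nonneg_nonneg)
          finally have "l ^ k * (exp (- x) * \<bar>f (x / l)\<bar>)
              \<le> l ^ k * (exp (- x) * (M * (x / l) ^ k * exp (x / 2)))"
            using l by (intro mult_left_mono) auto
          also have "\<dots> = M * x ^ k * (exp (- x) * exp (x / 2))"
            using l by (simp add: power_divide)
          also have "exp (- x) * exp (x / 2) = exp (- (x / 2))"
            by (simp flip: exp_add)
          finally show ?thesis
            using True l by (simp add: S_def w_def g_def abs_mult)
        next
          case False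
          with elim l have "x / l < 0" by (simp add: field_simps)
          then show ?thesis using False elim by (simp add: S_def w_def g_def)
        qed
      qed
    qed
    show "AE x in lborel. ((\<lambda>l. S l x) \<longlongrightarrow> L x) at_top"
      using ae
    proof eventually_elim
      case (elim x)
      show ?case
      proof (cases "x > 0")
        case True
        have "filterlim (\<lambda>l. x / l) (at_right 0) at_top"
          using True by real_asymp
        then have "((\<lambda>l. f (x / l) / (x / l) ^ k) \<longlongrightarrow> a) at_top"
          using lt unfolding leading_term_def by (rule filterlim_compose[rotated])
        then have "((\<lambda>l. x ^ k * exp (- x) * (f (x / l) / (x / l) ^ k)) \<longlongrightarrow> x ^ k * exp (- x) * a) at_top"
          by (intro tendsto_intros)
        moreover have "x ^ k * exp (- x) * a = L x"
          using True by (simp add: L_def)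
        moreover have "\<forall>\<^sub>F l in at_top. x ^ k * exp (- x) * (f (x / l) / (x / l) ^ k) = S l x"
          using eventually_gt_at_top[of 0]
          by eventually_elim (use True in \<open>simp add: S_def g_def power_divide field_simps\<close>)
        ultimately show ?thesis
          by (auto intro: Lim_transform_eventually)
      next
        case False
        have "\<forall>\<^sub>F l in at_top. L x = S l x"
          using eventually_gt_at_top[of 0]
        proof eventually_elim
          case (elim l)
          then have "x / l < 0" using False \<open>x \<noteq> 0\<close> by (simp add: field_simps)
          then show ?case using False \<open>x \<noteq> 0\<close> by (simp add: L_def S_def g_def)
        qed
        then show ?thesis
          by (rule Lim_transform_eventually[rotated]) simp
      qed
    qed
  qed (auto simp: S_def L_def)
  moreover have "(\<integral>x. L x \<partial>lborel) = a * fact k"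
    using has_bochner_integral_I0i_power_exp_m'[of k] by (simp add: L_def has_bochner_integral_iff)
  moreover have "\<forall>\<^sub>F l in at_top. (\<integral>x. S l x \<partial>lborel) = l ^ (k + 1) * real_laplace f l"
    using eventually_gt_at_top[of 0] by eventually_elim (simp only: scale)
  ultimately show ?thesis
    by (auto intro: Lim_transform_eventually)
qed


lemma leading_term_unique: "leading_term f k a \<Longrightarrow> leading_term f k b \<Longrightarrow> a = b"
  unfolding leading_term_def by (rule tendsto_unique[OF trivial_limit_at_right_real])

lemma leading_term_diff:
  "leading_term f k a \<Longrightarrow> leading_term g k b \<Longrightarrow> leading_term (\<lambda>t. f t - g t) k (a - b)"
  unfolding leading_term_def diff_divide_distrib by (rule tendsto_diff)

lemma leading_term_mult:
  assumes "leading_term f k a" "leading_term g j b"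
  shows "leading_term (\<lambda>t. f t * g t) (k + j) (a * b)"
  using tendsto_mult[OF assms[unfolded leading_term_def]]
  by (simp add: leading_term_def power_add)

lemma leading_term_power:
  assumes "leading_term f k a"
  shows "leading_term (\<lambda>t. f t ^ n) (k * n) (a ^ n)"
  using tendsto_power[OF assms[unfolded leading_term_def], of n]
  by (simp add: leading_term_def power_divide power_mult)

lemma leading_term_lower:
  assumes "leading_term f k a" "l < k"
  shows "leading_term f l 0"
proof -
  have zero: "a * 0 ^ (k - l) = 0" using assms(2) by simp
  have "((\<lambda>t. f t / t ^ k * t ^ (k - l)) \<longlongrightarrow> a * 0 ^ (k - l)) (at_right 0)"
    using assms(1) unfolding leading_term_def by (intro tendsto_intros)
  moreover have "\<forall>\<^sub>F t in at_right 0. f t / t ^ k * t ^ (k - l) = f t / t ^ l"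
    using eventually_at_right_less[of 0]
  proof eventually_elim
    case (elim t)
    have "t ^ k = t ^ l * t ^ (k - l)" using assms(2) by (simp flip: power_add)
    then show ?case using elim by simp
  qed
  ultimately show ?thesis
    unfolding leading_term_def zero by (rule Lim_transform_eventually)
qed

text \<open>The factorisation of \<open>x ^ n - y ^ n\<close> as \<open>x - y\<close> times a form of degree \<open>n - 1\<close> gives the order
  of \<open>p ^ n - q ^ n\<close> from that of \<open>p - q\<close>. The two coefficients \<open>a\<close> and \<open>b\<close> may differ, which is
  the case when \<open>p\<close> and \<open>q\<close> are shifted to a point where their values could differ.\<close>

lemma leading_term_power_diff:
  assumes p: "leading_term p k a" and q: "leading_term q k b"
    and pq: "leading_term (\<lambda>t. p t - q t) l c"
  shows "leading_term (\<lambda>t. p t ^ n - q t ^ n) (l + k * (n - 1))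
           (c * (\<Sum>i<n. b ^ (n - Suc i) * a ^ i))"
proof -
  have "((\<lambda>t. (p t - q t) / t ^ l * (\<Sum>i<n. (q t / t ^ k) ^ (n - Suc i) * (p t / t ^ k) ^ i))
      \<longlongrightarrow> c * (\<Sum>i<n. b ^ (n - Suc i) * a ^ i)) (at_right 0)"
    using assms unfolding leading_term_def by (intro tendsto_intros)
  moreover have "(p t - q t) / t ^ l * (\<Sum>i<n. (q t / t ^ k) ^ (n - Suc i) * (p t / t ^ k) ^ i)
      = (p t ^ n - q t ^ n) / t ^ (l + k * (n - 1))" for t
  proof -
    have "(q t / t ^ k) ^ (n - Suc i) * (p t / t ^ k) ^ i
        = q t ^ (n - Suc i) * p t ^ i / t ^ (k * (n - 1))" if "i < n" for i
    proof -
      have "t ^ (k * (n - 1)) = (t ^ k) ^ (n - Suc i) * (t ^ k) ^ i"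
        using that by (simp flip: power_mult power_add distrib_left)
      then show ?thesis by (simp add: power_divide)
    qed
    then have "(\<Sum>i<n. (q t / t ^ k) ^ (n - Suc i) * (p t / t ^ k) ^ i)
        = (\<Sum>i<n. q t ^ (n - Suc i) * p t ^ i) / t ^ (k * (n - 1))"
      by (simp add: sum_divide_distrib)
    then show ?thesis
      by (simp add: power_diff_sumr2 power_add)
  qed
  ultimately show ?thesis
    by (simp add: leading_term_def)
qed

lemma watson_product:
  assumes "transformable f" "leading_term f k a" "transformable g" "leading_term g j b"
  shows "((\<lambda>l. l ^ (k + j + 2) * (real_laplace f l * real_laplace g l))
           \<longlongrightarrow> a * fact k * (b * fact j)) at_top"
  using tendsto_mult[OF watson_leading_term[OF assms(1,2)] watson_leading_term[OF assms(3,4)]]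
  by (simp add: power_add mult_ac)

text \<open>By Watson's lemma one function of \<open>l\<close> converges both after multiplication by \<open>l ^ (k + j + 2)\<close>,
  with limit determined by \<open>f\<close> and \<open>g\<close>, and after multiplication by \<open>l ^ (k' + j' + 2)\<close>, with limit
  determined by \<open>f'\<close> and \<open>g'\<close>. If the second power is higher, the first limit must be \<open>0\<close>; if the
  powers are equal, so are the limits.\<close>

lemma laplace_product_identity:
  assumes f: "transformable f" "leading_term f k a" and g: "transformable g" "leading_term g j b"
    and f': "transformable f'" "leading_term f' k' a'" and g': "transformable g'" "leading_term g' j' b'"
    and eq: "\<forall>\<^sub>F l in at_top. real_laplace f l * real_laplace g l = real_laplace f' l * real_laplace g' l"
  shows laplace_product_identity_order: "k + j < k' + j' \<Longrightarrow> a * b = 0"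
    and laplace_product_identity_coeff:
      "k + j = k' + j' \<Longrightarrow> a * b * (fact k * fact j) = a' * b' * (fact k' * fact j')"
proof -
  have lim: "((\<lambda>l. l ^ (k + j + 2) * (real_laplace f l * real_laplace g l))
      \<longlongrightarrow> a * fact k * (b * fact j)) at_top"
    using f g by (rule watson_product)
  have "((\<lambda>l. l ^ (k' + j' + 2) * (real_laplace f' l * real_laplace g' l))
      \<longlongrightarrow> a' * fact k' * (b' * fact j')) at_top"
    using f' g' by (rule watson_product)
  then have lim': "((\<lambda>l. l ^ (k' + j' + 2) * (real_laplace f l * real_laplace g l))
      \<longlongrightarrow> a' * fact k' * (b' * fact j')) at_top"
    by (rule Lim_transform_eventually) (use eq in eventually_elim, simp)
  show "a * b = 0" if less: "k + j < k' + j'"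
  proof -
    define e where "e = k' + j' - (k + j)"
    have e: "e > 0" "k' + j' + 2 = e + (k + j + 2)" using less by (auto simp: e_def)
    have "((\<lambda>l::real. inverse l ^ e) \<longlongrightarrow> 0 ^ e) at_top"
      by (intro tendsto_power tendsto_inverse_0_at_top filterlim_ident)
    then have "((\<lambda>l::real. inverse l ^ e) \<longlongrightarrow> 0) at_top"
      by (simp only: zero_power[OF e(1)])
    from tendsto_mult[OF this lim']
    have "((\<lambda>l. inverse l ^ e * (l ^ (k' + j' + 2) * (real_laplace f l * real_laplace g l))) \<longlongrightarrow> 0) at_top"
      by (simp only: mult_zero_left)
    moreover have "\<forall>\<^sub>F l::real in at_top.
        inverse l ^ e * (l ^ (k' + j' + 2) * (real_laplace f l * real_laplace g l))
          = l ^ (k + j + 2) * (real_laplace f l * real_laplace g l)"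
      using eventually_gt_at_top[of 0]
      by eventually_elim (unfold e(2) power_add[of _ e], simp add: power_inverse)
    ultimately have "((\<lambda>l. l ^ (k + j + 2) * (real_laplace f l * real_laplace g l)) \<longlongrightarrow> 0) at_top"
      by (rule Lim_transform_eventually)
    from tendsto_unique[OF _ this lim] show ?thesis by simp
  qed
  show "a * b * (fact k * fact j) = a' * b' * (fact k' * fact j')" if "k + j = k' + j'"
    using tendsto_unique[OF _ lim lim'[folded that]] by (simp add: mult_ac)
qed

section \<open>Germs of right analytic functions\<close>

text \<open>The hypothesis speaks of positive \<open>h\<close> only, but a power series converging there has a full disc
  of convergence, so its sum is continuous at \<open>0\<close>.\<close>

lemma power_series_limit_at_right:
  fixes b :: "nat \<Rightarrow> real"
  assumes "d > 0" and "\<And>h. 0 < h \<Longrightarrow> h < d \<Longrightarrow> (\<lambda>i. b i * h ^ i) sums f h"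
  shows "(f \<longlongrightarrow> b 0) (at_right 0)"
proof -
  have "(\<lambda>i. b i * x ^ i) sums (\<Sum>i. b i * x ^ i)" if "norm x < d" for x
  proof -
    obtain y where "norm x < y" "y < d" using \<open>norm x < d\<close> dense by blast
    then have "summable (\<lambda>i. b i * y ^ i)" "norm x < norm y"
      using assms(2)[of y] by (auto simp: sums_iff)
    then show ?thesis by (rule summable_sums[OF powser_inside])
  qed
  then have "((\<lambda>x. \<Sum>i. b i * x ^ i) \<longlongrightarrow> b 0) (at 0)"
    using assms(1) by (rule powser_limit_0[rotated])
  then have "((\<lambda>x. \<Sum>i. b i * x ^ i) \<longlongrightarrow> b 0) (at_right 0)"
    by (rule tendsto_mono[OF at_le, rotated]) simp
  moreover have "\<forall>\<^sub>F h in at_right 0. (\<Sum>i. b i * h ^ i) = f h"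
    using eventually_at_right_less[of 0] eventually_at_right_real[OF assms(1)]
    by eventually_elim (use assms(2) in \<open>auto simp: sums_iff\<close>)
  ultimately show ?thesis by (rule Lim_transform_eventually)
qed

lemma right_analytic_atE:
  assumes "right_analytic_at f s"
  obtains d a where "d > 0" "\<And>h. 0 \<le> h \<Longrightarrow> h < d \<Longrightarrow> (\<lambda>i. a i * h ^ i) sums f (s + h)"
proof -
  obtain d a where "d > 0" "\<forall>t\<in>{s..<s + d}. (\<lambda>i. a i * (t - s) ^ i) sums f t"
    using assms unfolding right_analytic_at_def by blast
  then show thesis by (intro that[of d a]) (auto dest: bspec[of _ _ "s + _"])
qed

lemma right_analytic_at_diff:
  assumes "right_analytic_at f s" "right_analytic_at g s"
  shows "right_analytic_at (\<lambda>x. f x - g x) s"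
proof -
  obtain d a where f: "d > 0" "\<forall>t\<in>{s..<s + d}. (\<lambda>i. a i * (t - s) ^ i) sums f t"
    using assms(1) unfolding right_analytic_at_def by blast
  obtain e b where g: "e > 0" "\<forall>t\<in>{s..<s + e}. (\<lambda>i. b i * (t - s) ^ i) sums g t"
    using assms(2) unfolding right_analytic_at_def by blast
  show ?thesis
    unfolding right_analytic_at_def
  proof (intro exI conjI ballI)
    fix t assume "t \<in> {s..<s + min d e}"
    then show "(\<lambda>i. (a i - b i) * (t - s) ^ i) sums (f t - g t)"
      using f g by (auto simp: left_diff_distrib intro!: sums_diff)
  qed (use f g in auto)
qed

lemma right_analytic_at_leading_term_0:
  assumes "right_analytic_at f s"
  shows "leading_term (\<lambda>h. f (s + h)) 0 (f s)"
proof -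
  obtain d a where a: "d > 0" "\<And>h. 0 \<le> h \<Longrightarrow> h < d \<Longrightarrow> (\<lambda>i. a i * h ^ i) sums f (s + h)"
    using assms by (rule right_analytic_atE) blast
  have "(\<lambda>i. a i * 0 ^ i) sums f s" using a(2)[of 0] a(1) by simp
  then have "a 0 = f s" by (simp add: sums_iff)
  moreover have "((\<lambda>h. f (s + h)) \<longlongrightarrow> a 0) (at_right 0)"
    using a by (intro power_series_limit_at_right[of d]) auto
  ultimately show ?thesis by (simp add: leading_term_def)
qed

text \<open>Either all coefficients of the expansion vanish, or the first nonzero one can be divided out.
  This dichotomy is what analyticity contributes to the uniqueness proof.\<close>

lemma right_analytic_at_zero_or_leading_term:
  assumes "right_analytic_at f s"
  obtains (zero) d where "d > 0" "\<And>t. s \<le> t \<Longrightarrow> t < s + d \<Longrightarrow> f t = 0"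
  | (leading) k a where "a \<noteq> 0" "leading_term (\<lambda>h. f (s + h)) k a"
proof -
  obtain d a where a: "d > 0" "\<And>h. 0 \<le> h \<Longrightarrow> h < d \<Longrightarrow> (\<lambda>i. a i * h ^ i) sums f (s + h)"
    using assms by (rule right_analytic_atE) blast
  show thesis
  proof (cases "\<forall>i. a i = 0")
    case True
    have "f t = 0" if "s \<le> t" "t < s + d" for t
      using a(2)[of "t - s"] that True by (simp add: sums_iff)
    then show thesis using zero a(1) by blast
  next
    case False
    define k where "k = (LEAST i. a i \<noteq> 0)"
    have k: "a k \<noteq> 0" using LeastI_ex[of "\<lambda>i. a i \<noteq> 0"] False by (simp add: k_def)
    have less: "a i = 0" if "i < k" for i using not_less_Least[of i "\<lambda>i. a i \<noteq> 0"] that by (simp add: k_def)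
    have "((\<lambda>h. f (s + h) / h ^ k) \<longlongrightarrow> a (0 + k)) (at_right 0)"
    proof (rule power_series_limit_at_right[OF a(1)])
      fix h :: real assume h: "0 < h" "h < d"
      have "(\<lambda>i. a (i + k) * h ^ (i + k)) sums f (s + h)"
        using a(2)[of h] h less sums_zero_iff_shift[of k "\<lambda>i. a i * h ^ i"] by simp
      from sums_divide[OF this, of "h ^ k"]
      show "(\<lambda>i. a (i + k) * h ^ i) sums (f (s + h) / h ^ k)"
        using h by (simp add: power_add)
    qed
    then show thesis using leading k by (simp add: leading_term_def)
  qed
qed

text \<open>A right analytic function need not be continuous, nor even have left limits, but it is right
  continuous. It is therefore the pointwise limit of the step functions that sample it at the
  next larger multiple of \<open>1 / (j + 1)\<close>.\<close>

lemma right_analytic_set_borel_measurable: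
  assumes "right_analytic f"
  shows "set_borel_measurable borel {0..} f"
proof -
  \<comment> \<open>Adding 1 to the floor makes \<open>u j x\<close> lie strictly to the right of \<open>x\<close>, also at grid points.\<close>
  define u where "u = (\<lambda>j x. (of_int \<lfloor>real (Suc j) * x\<rfloor> + 1) / real (Suc j))"
  have u: "x < u j x" "u j x \<le> x + inverse (real (Suc j))" for j x
  proof -
    define N where "N = real (Suc j)"
    have N: "N > 0" by (simp add: N_def)
    have "N * x < of_int \<lfloor>N * x\<rfloor> + 1" "of_int \<lfloor>N * x\<rfloor> + 1 \<le> N * x + 1" by linarith+
    then have "x < (of_int \<lfloor>N * x\<rfloor> + 1) / N" "(of_int \<lfloor>N * x\<rfloor> + 1) / N \<le> (N * x + 1) / N"
      using N by (simp_all add: pos_less_divide_eq mult.commute divide_right_mono)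
    moreover have "(N * x + 1) / N = x + inverse N" using N by (simp add: field_simps)
    ultimately show "x < u j x" "u j x \<le> x + inverse (real (Suc j))"
      by (simp_all only: u_def N_def)
  qed
  show ?thesis
    unfolding set_borel_measurable_def
  proof (rule borel_measurable_LIMSEQ_real)
    fix j
    have "(\<lambda>i::int. f ((of_int i + 1) / real (Suc j))) \<circ> (\<lambda>x. \<lfloor>real (Suc j) * x\<rfloor>) \<in> borel_measurable borel"
      by (rule measurable_comp[of _ _ "count_space UNIV"]) auto
    then have [measurable]: "(\<lambda>x. f (u j x)) \<in> borel_measurable borel"
      by (simp add: u_def comp_def)
    show "(\<lambda>x. indicator {0..} x *\<^sub>R f (u j x)) \<in> borel_measurable borel"
      by measurable
  next
    fix x :: real
    show "(\<lambda>j. indicator {0..} x *\<^sub>R f (u j x)) \<longlonglongrightarrow> indicator {0..} x *\<^sub>R f x"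
    proof (cases "x \<ge> 0")
      case True
      then have "leading_term (\<lambda>h. f (x + h)) 0 (f x)"
        using assms right_analytic_at_leading_term_0 unfolding right_analytic_def by blast
      moreover have "filterlim (\<lambda>j. u j x - x) (at_right 0) sequentially"
        unfolding filterlim_at
      proof
        show "\<forall>\<^sub>F j in sequentially. u j x - x \<in> {0<..} \<and> u j x - x \<noteq> 0"
          using u(1)[of x] by (auto intro!: always_eventually simp: less_imp_neq[THEN not_sym])
        show "(\<lambda>j. u j x - x) \<longlonglongrightarrow> 0"
        proof (rule tendsto_sandwich[OF _ _ tendsto_const LIMSEQ_inverse_real_of_nat])
          show "\<forall>\<^sub>F j in sequentially. 0 \<le> u j x - x"
            using u(1)[of x] by (auto intro!: always_eventually less_imp_le)
          show "\<forall>\<^sub>F j in sequentially. u j x - x \<le> inverse (real (Suc j))"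
            using u(2)[of _ x] by (auto intro!: always_eventually simp: algebra_simps)
        qed
      qed
      ultimately have "(\<lambda>j. f (x + (u j x - x)) / (u j x - x) ^ 0) \<longlonglongrightarrow> f x"
        unfolding leading_term_def by (rule filterlim_compose)
      then show ?thesis using True by simp
    qed simp
  qed
qed

lemma right_analytic_transformable:
  "right_analytic f \<Longrightarrow> exponential_order f \<Longrightarrow> transformable f"
  unfolding transformable_def using right_analytic_set_borel_measurable by blast

lemma inf_set_eq_0D:
  assumes "inf_set A = 0" "d > 0"
  obtains x where "x \<in> A" "x < d"
proof -
  have "Inf (ereal ` A) < ereal d" using assms by (simp add: inf_set_def)
  then show thesis using that by (auto simp: Inf_less_iff)
qed

lemma inf_support_zero_imp_leading_term:
  assumes "right_analytic f" "inf_set {x. 0 < x \<and> f x \<noteq> 0} = 0"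
  obtains k a where "a \<noteq> 0" "leading_term f k a"
proof -
  have "right_analytic_at f 0" using assms(1) by (simp add: right_analytic_def)
  then show thesis
  proof (cases rule: right_analytic_at_zero_or_leading_term)
    case (zero d)
    obtain x where "0 < x" "f x \<noteq> 0" "x < d"
      using inf_set_eq_0D[OF assms(2) zero(1)] by blast
    then show thesis using zero(2)[of x] by simp
  next
    case (leading k a)
    then show thesis using that by simp
  qed
qed

section \<open>Uniqueness\<close>

text \<open>The denominators of \<open>H\<close> are nonzero for large arguments by Watson's lemma, so the fractions can
  be cleared.\<close>

lemma H_eq_imp_laplace_product_eq:
  assumes p: "transformable p" "leading_term p k a" "a \<noteq> 0"
    and q: "transformable q" "leading_term q j b" "b \<noteq> 0"
    and eq: "\<forall>\<^sub>F l :: real in at_top. H n m p (of_real l) = H n m q (of_real l)"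
  shows "\<forall>\<^sub>F l in at_top. real_laplace (\<lambda>x. p x ^ n) l * real_laplace (\<lambda>x. q x ^ m) l
           = real_laplace (\<lambda>x. q x ^ n) l * real_laplace (\<lambda>x. p x ^ m) l"
proof -
  have ne: "\<forall>\<^sub>F l in at_top. real_laplace (\<lambda>x. f x ^ m) l \<noteq> 0"
    if "transformable f" "leading_term f i c" "c \<noteq> 0" for f i c
  proof -
    have "((\<lambda>l. l ^ (i * m + 1) * real_laplace (\<lambda>x. f x ^ m) l) \<longlongrightarrow> c ^ m * fact (i * m)) at_top"
      using that by (intro watson_leading_term transformable_power leading_term_power)
    then have "\<forall>\<^sub>F l in at_top. l ^ (i * m + 1) * real_laplace (\<lambda>x. f x ^ m) l \<noteq> 0"
      by (rule tendsto_imp_eventually_ne) (use that in simp)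
    then show ?thesis by eventually_elim auto
  qed
  show ?thesis
    using eq ne[OF p] ne[OF q]
    by eventually_elim
       (auto simp: H_def laplace_transform_of_real field_simps simp flip: of_real_mult of_real_divide)
qed

text \<open>The two sides of the identity have orders \<open>k * n + j * m\<close> and \<open>j * n + k * m\<close>. They coincide, so
  \<open>(k - j) * (n - m) = 0\<close>; with equal orders the factorials cancel from the coefficients.\<close>

lemma leading_terms_agree:
  assumes p: "transformable p" "leading_term p k a" "a \<noteq> 0"
    and q: "transformable q" "leading_term q j b" "b \<noteq> 0"
    and "m < n"
    and eq: "\<forall>\<^sub>F l in at_top. real_laplace (\<lambda>x. p x ^ n) l * real_laplace (\<lambda>x. q x ^ m) l
           = real_laplace (\<lambda>x. q x ^ n) l * real_laplace (\<lambda>x. p x ^ m) l"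
  shows "k = j" "a ^ (n - m) = b ^ (n - m)"
proof -
  note facts = transformable_power[OF p(1)] leading_term_power[OF p(2)]
    transformable_power[OF q(1)] leading_term_power[OF q(2)]
  have eq': "\<forall>\<^sub>F l in at_top. real_laplace (\<lambda>x. q x ^ n) l * real_laplace (\<lambda>x. p x ^ m) l
           = real_laplace (\<lambda>x. p x ^ n) l * real_laplace (\<lambda>x. q x ^ m) l"
    using eq by eventually_elim simp
  have "\<not> k * n + j * m < j * n + k * m"
    using laplace_product_identity_order[OF facts(1-4) facts(3,4,1,2) eq] p q by auto
  moreover have "\<not> j * n + k * m < k * n + j * m"
    using laplace_product_identity_order[OF facts(3,4,1,2) facts(1-4) eq'] p q by auto
  ultimately have sum: "k * n + j * m = j * n + k * m" by simp
  obtain e where e: "n = m + e" "e > 0" using \<open>m < n\<close> less_imp_add_positive by blast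
  show kj: "k = j" using sum e by (simp add: algebra_simps)
  have "a ^ n * b ^ m = b ^ n * a ^ m"
    using laplace_product_identity_coeff[OF facts(1-4) facts(3,4,1,2) eq sum] kj by simp
  then show "a ^ (n - m) = b ^ (n - m)"
    using e p q by (simp add: power_add)
qed

text \<open>Subtracting \<open>L (q ^ n) * L (q ^ m)\<close> from both sides makes the differences \<open>p ^ i - q ^ i\<close> appear.
  Both vanish on \<open>[0, s)\<close>, so shifting them to \<open>s\<close> produces the same factor \<open>exp (- (l * s))\<close> on
  either side. The other factors keep their expansion at \<open>0\<close>.\<close>

lemma laplace_identity_after_agreement:
  assumes p: "transformable p" and q: "transformable q"
    and eq: "\<forall>\<^sub>F l in at_top. real_laplace (\<lambda>x. p x ^ n) l * real_laplace (\<lambda>x. q x ^ m) l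
           = real_laplace (\<lambda>x. q x ^ n) l * real_laplace (\<lambda>x. p x ^ m) l"
    and s: "s \<ge> 0" and agree: "\<And>x. 0 \<le> x \<Longrightarrow> x < s \<Longrightarrow> p x = q x"
  shows "\<forall>\<^sub>F l in at_top.
      real_laplace (\<lambda>x. p (s + x) ^ n - q (s + x) ^ n) l * real_laplace (\<lambda>x. q x ^ m) l
    = real_laplace (\<lambda>x. p (s + x) ^ m - q (s + x) ^ m) l * real_laplace (\<lambda>x. q x ^ n) l"
proof -
  have diff: "\<forall>\<^sub>F l in at_top. real_laplace (\<lambda>x. p x ^ i - q x ^ i) l
      = real_laplace (\<lambda>x. p x ^ i) l - real_laplace (\<lambda>x. q x ^ i) l" for i
    using p q by (intro eventually_real_laplace_diff transformable_power)
  have shift: "real_laplace (\<lambda>x. p x ^ i - q x ^ i) l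
      = exp (- (l * s)) * real_laplace (\<lambda>x. p (s + x) ^ i - q (s + x) ^ i) l" for i l
    using s agree by (intro real_laplace_shift) auto
  show ?thesis
    using eq diff[of n] diff[of m]
  proof eventually_elim
    case (elim l)
    have "real_laplace (\<lambda>x. p x ^ n - q x ^ n) l * real_laplace (\<lambda>x. q x ^ m) l
        = real_laplace (\<lambda>x. p x ^ m - q x ^ m) l * real_laplace (\<lambda>x. q x ^ n) l"
      unfolding elim(2,3) using elim(1) by (simp add: algebra_simps)
    then show ?case unfolding shift by simp
  qed
qed

text \<open>The quotient \<open>(N + d)! / N!\<close> is the product of the factors \<open>N + 1, \<dots>, N + d\<close>, each of which grows
  with \<open>N\<close>; here it is written without division.\<close>

lemma fact_quotient_mono:
  assumes "M \<le> N"
  shows "fact (M + d) * fact N \<le> (fact (N + d) * fact M :: real)"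
proof (induction d)
  case (Suc d)
  have "fact (M + Suc d) * fact N = real (Suc (M + d)) * (fact (M + d) * fact N)"
    by (simp add: mult_ac)
  also have "\<dots> \<le> real (Suc (N + d)) * (fact (N + d) * fact M)"
    using assms by (intro mult_mono[OF _ Suc]) auto
  also have "\<dots> = fact (N + Suc d) * fact M"
    by (simp add: mult_ac)
  finally show ?case .
qed simp

lemma sum_power_same: "(\<Sum>i<n. a ^ (n - Suc i) * a ^ i) = real n * a ^ (n - 1)"
proof -
  have "(\<Sum>i<n. a ^ (n - Suc i) * a ^ i) = (\<Sum>i<n. a ^ (n - 1))"
    by (intro sum.cong refl) (auto simp flip: power_add)
  then show ?thesis by simp
qed

text \<open>If \<open>p - q\<close> had a nonzero leading coefficient \<open>c\<close> at order \<open>k + d\<close>, both sides of the identity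
  for differences would have order \<open>(k * n + d) + k * m\<close>, and only the coefficients can decide. They
  contain \<open>n * (k * n + d)! * (k * m)!\<close> and \<open>m * (k * m + d)! * (k * n)!\<close>, and the first
  is larger: the quotients of factorials compare weakly, the factors \<open>m < n\<close> strictly.\<close>

lemma agreement_at_0:
  assumes p: "right_analytic p" "transformable p" "leading_term p k a"
    and q: "right_analytic q" "transformable q" "leading_term q k a"
    and a: "a \<noteq> 0" and nm: "1 \<le> m" "m < n"
    and eq: "\<forall>\<^sub>F l in at_top. real_laplace (\<lambda>x. p x ^ n) l * real_laplace (\<lambda>x. q x ^ m) l
           = real_laplace (\<lambda>x. q x ^ n) l * real_laplace (\<lambda>x. p x ^ m) l"
  shows "\<exists>d>0. \<forall>t. 0 \<le> t \<and> t < d \<longrightarrow> p t = q t"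
proof -
  have "right_analytic_at (\<lambda>t. p t - q t) 0"
    using p q by (auto simp: right_analytic_def intro: right_analytic_at_diff)
  then show ?thesis
  proof (cases rule: right_analytic_at_zero_or_leading_term)
    case (zero d)
    then show ?thesis by force
  next
    case (leading l c)
    then have lc: "leading_term (\<lambda>t. p t - q t) l c" by simp
    \<comment> \<open>The leading terms of \<open>p\<close> and \<open>q\<close> cancel in the difference.\<close>
    have "\<not> l < k"
    proof
      assume "l < k"
      with leading_term_lower leading_term_diff[OF p(3) q(3)]
      have "leading_term (\<lambda>t. p t - q t) l 0" by blast
      then show False using leading_term_unique lc \<open>c \<noteq> 0\<close> by blast
    qed
    then obtain d where l: "l = k + d" using le_Suc_ex not_less by blast
    have lead: "leading_term (\<lambda>t. p t ^ i - q t ^ i) (k * i + d) (c * (real i * a ^ (i - 1)))"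
      if "i \<ge> 1" for i
    proof -
      have "l + k * (i - 1) = k * i + d" using that l by (cases i) auto
      then show ?thesis
        using leading_term_power_diff[OF p(3) q(3) lc, of i] by (simp add: sum_power_same)
    qed
    have tr: "transformable (\<lambda>t. p t ^ i - q t ^ i)" for i
      using p q by (intro transformable_diff transformable_power)
    have "\<forall>\<^sub>F l in at_top.
        real_laplace (\<lambda>x. p x ^ n - q x ^ n) l * real_laplace (\<lambda>x. q x ^ m) l
      = real_laplace (\<lambda>x. p x ^ m - q x ^ m) l * real_laplace (\<lambda>x. q x ^ n) l"
      using laplace_identity_after_agreement[OF p(2) q(2) eq, of 0] by simp
    then have "c * (real n * a ^ (n - 1)) * a ^ m * (fact (k * n + d) * fact (k * m))
        = c * (real m * a ^ (m - 1)) * a ^ n * (fact (k * m + d) * fact (k * n))"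
      using laplace_product_identity_coeff[OF tr lead transformable_power[OF q(2)]
          leading_term_power[OF q(3)] tr lead transformable_power[OF q(2)]
          leading_term_power[OF q(3)], of n m m n] nm by simp
    moreover have "a ^ n = a * a ^ (n - 1)" "a ^ m = a * a ^ (m - 1)"
      using nm by (simp_all flip: power_Suc)
    ultimately have "real n * (fact (k * n + d) * fact (k * m)) = real m * (fact (k * m + d) * fact (k * n))"
      using a \<open>c \<noteq> 0\<close> by (simp add: mult_ac)
    moreover have "real m * (fact (k * m + d) * fact (k * n)) \<le> real m * (fact (k * n + d) * fact (k * m))"
      using nm by (intro mult_left_mono fact_quotient_mono) auto
    moreover have "real m * (fact (k * n + d) * fact (k * m)) < real n * (fact (k * n + d) * fact (k * m))"
      using nm by (intro mult_strict_right_mono) auto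
    ultimately show ?thesis by linarith
  qed
qed

text \<open>Comparing orders suffices: \<open>P ^ n - Q ^ n\<close> and \<open>P ^ m - Q ^ m\<close>, shifted to \<open>s\<close>, would both be
  \<open>O(t ^ l)\<close>, while \<open>q ^ n\<close> vanishes to higher order at \<open>0\<close> than \<open>q ^ m\<close> because \<open>k \<ge> 1\<close>. So the
  coefficient of \<open>P ^ n - Q ^ n\<close> at order \<open>l\<close> is \<open>0\<close>. This first gives \<open>p s ^ n = q s ^ n\<close>, hence
  \<open>p s = q s\<close>, and then the coefficient is \<open>c * n * p s ^ (n - 1)\<close>, which is not \<open>0\<close>.\<close>

lemma agreement_continues:
  assumes p: "right_analytic p" "transformable p"
    and q: "right_analytic q" "transformable q" "leading_term q k a"
    and a: "a \<noteq> 0" and k: "k \<ge> 1" and nm: "m < n"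
    and eq: "\<forall>\<^sub>F l in at_top. real_laplace (\<lambda>x. p x ^ n) l * real_laplace (\<lambda>x. q x ^ m) l
           = real_laplace (\<lambda>x. q x ^ n) l * real_laplace (\<lambda>x. p x ^ m) l"
    and s: "s \<ge> 0" and agree: "\<And>x. 0 \<le> x \<Longrightarrow> x < s \<Longrightarrow> p x = q x"
    and nz: "p s \<noteq> 0" and inj: "p s ^ n = q s ^ n \<Longrightarrow> p s = q s"
  shows "\<exists>d>0. \<forall>t. s \<le> t \<and> t < s + d \<longrightarrow> p t = q t"
proof -
  have an: "right_analytic_at p s" "right_analytic_at q s"
    using p q s by (auto simp: right_analytic_def)
  have "right_analytic_at (\<lambda>t. p t - q t) s"
    using an by (rule right_analytic_at_diff)
  then show ?thesis
  proof (cases rule: right_analytic_at_zero_or_leading_term)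
    case (zero d)
    then show ?thesis by force
  next
    case (leading l c)
    define A where "A = (\<lambda>i. \<Sum>j<i. q s ^ (i - Suc j) * p s ^ j)"
    have lead: "leading_term (\<lambda>t. p (s + t) ^ i - q (s + t) ^ i) l (c * A i)" for i
      using leading_term_power_diff[OF an[THEN right_analytic_at_leading_term_0] leading(2), of i]
      by (simp add: A_def)
    have tr: "transformable (\<lambda>t. p (s + t) ^ i - q (s + t) ^ i)" for i
      using transformable_shift[OF p(2) s] transformable_shift[OF q(2) s]
      by (intro transformable_diff transformable_power)
    have identity: "\<forall>\<^sub>F l in at_top.
        real_laplace (\<lambda>x. p (s + x) ^ n - q (s + x) ^ n) l * real_laplace (\<lambda>x. q x ^ m) l
      = real_laplace (\<lambda>x. p (s + x) ^ m - q (s + x) ^ m) l * real_laplace (\<lambda>x. q x ^ n) l"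
      using agree by (rule laplace_identity_after_agreement[OF p(2) q(2) eq s])
    have "l + k * m < l + k * n" using k nm by simp
    then have "c * A n * a ^ m = 0"
      using laplace_product_identity_order[OF tr lead transformable_power[OF q(2)]
          leading_term_power[OF q(3)] tr lead transformable_power[OF q(2)] leading_term_power[OF q(3)]
          identity] by blast
    then have "A n = 0" using a leading(1) by simp
    then have "p s ^ n - q s ^ n = 0" by (simp add: power_diff_sumr2 A_def)
    then have "p s = q s" using inj by simp
    then have "A n = real n * p s ^ (n - 1)" by (simp add: A_def sum_power_same)
    then show ?thesis using \<open>A n = 0\<close> nz nm by simp
  qed
qed

text \<open>Continuous induction: otherwise the infimum of the points of disagreement would have no
  disagreement to its left, hence none just to its right.\<close>

lemma agreement_everywhere:
  fixes p q :: "real \<Rightarrow> real"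
  assumes step: "\<And>s. s \<ge> 0 \<Longrightarrow> (\<And>x. 0 \<le> x \<Longrightarrow> x < s \<Longrightarrow> p x = q x)
      \<Longrightarrow> \<exists>d>0. \<forall>t. s \<le> t \<and> t < s + d \<longrightarrow> p t = q t"
  shows "\<forall>x\<ge>0. p x = q x"
proof (rule ccontr)
  assume differ: "\<not> (\<forall>x\<ge>0. p x = q x)"
  define B where "B = {x. x \<ge> 0 \<and> p x \<noteq> q x}"
  have B: "B \<noteq> {}" "bdd_below B" using differ by (auto simp: B_def intro!: bdd_belowI[of _ 0])
  have s: "Inf B \<ge> 0" using B(1) by (intro cInf_greatest) (auto simp: B_def)
  have below: "p x = q x" if "0 \<le> x" "x < Inf B" for x
    using that cInf_lower[OF _ B(2), of x] by (auto simp: B_def)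
  obtain d where d: "d > 0" "\<forall>t. Inf B \<le> t \<and> t < Inf B + d \<longrightarrow> p t = q t"
    using step[OF s below] by blast
  obtain x where x: "x \<in> B" "x < Inf B + d"
    using cInf_lessD[OF B(1), of "Inf B + d"] d(1) by auto
  have "Inf B \<le> x" using x(1) B(2) by (rule cInf_lower)
  then have "p x = q x" using d(2) x(2) by blast
  then show False using x(1) by (simp add: B_def)
qed

lemma power_eq_imp_eq_if_odd_or_same_sign:
  fixes x y :: real
  assumes "odd n \<or> n > 0 \<and> x * y > 0" and "x ^ n = y ^ n"
  shows "x = y"
proof (cases "odd n")
  case True
  then show ?thesis by (metis assms(2) odd_real_root_power_cancel)
next
  case False
  then have *: "n > 0" "x * y > 0" using assms(1) by auto
  have "\<bar>x\<bar> ^ n = \<bar>y\<bar> ^ n" using assms(2) by (simp flip: power_abs)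
  then have "\<bar>x\<bar> = \<bar>y\<bar>" using * by (simp add: power_eq_iff_eq_base)
  then show ?thesis using *(2) by (auto simp: abs_if zero_less_mult_iff split: if_splits)
qed

theorem theorem2p2:
  fixes n m :: nat and p q :: "real \<Rightarrow> real"
  assumes "1 \<le> m" and "m < n" and "coprime n m"
    and "right_analytic p" and "right_analytic q"
    and "exponential_order p" and "exponential_order q"
    and "inf_set {x. 0 < x \<and> p x \<noteq> 0} = 0"
    and "inf_set {x. 0 < x \<and> q x \<noteq> 0} = 0"
    and "p 0 = 0"
    and "(odd n \<and> even m \<and> (\<forall>t>0. p t \<noteq> 0))
       \<or> (odd n \<and> odd m \<and> (\<forall>t>0. p t \<noteq> 0) \<and> inf_set {t. 0 \<le> t \<and> p t * q t > 0} = 0)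
       \<or> (even n \<and> (\<forall>t>0. p t * q t > 0))"
    and "\<forall>\<^sub>F l :: real in at_top. H n m p (of_real l) = H n m q (of_real l)"
  shows "\<forall>x\<ge>0. p x = q x"
proof -
  note nm = assms(1,2) and an = assms(4,5) and cond = assms(11)
  have tr: "transformable p" "transformable q"
    using assms by (auto intro: right_analytic_transformable)
  obtain k a where p: "a \<noteq> 0" "leading_term p k a"
    using inf_support_zero_imp_leading_term[OF an(1) assms(8)] by blast
  obtain j b where q: "b \<noteq> 0" "leading_term q j b"
    using inf_support_zero_imp_leading_term[OF an(2) assms(9)] by blast
  have eq: "\<forall>\<^sub>F l in at_top. real_laplace (\<lambda>x. p x ^ n) l * real_laplace (\<lambda>x. q x ^ m) l
           = real_laplace (\<lambda>x. q x ^ n) l * real_laplace (\<lambda>x. p x ^ m) l"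
    by (rule H_eq_imp_laplace_product_eq[OF tr(1) p(2,1) tr(2) q(2,1) assms(12)])
  note agree = leading_terms_agree[OF tr(1) p(2,1) tr(2) q(2,1) nm(2) eq]
  \<comment> \<open>For coprime exponents of different parity \<open>n - m\<close> is odd, so \<open>(n - m)\<close>-th powers determine
      their base; otherwise the points near \<open>0\<close> with \<open>p t * q t > 0\<close> fix the sign.\<close>
  have "odd (n - m) \<or> n - m > 0 \<and> a * b > 0"
  proof (cases "odd n \<and> odd m")
    case False
    moreover have "\<not> (even n \<and> even m)"
      using assms(3) by (metis coprime_common_divisor odd_one)
    ultimately show ?thesis using nm by auto
  next
    case True
    then have inf: "inf_set {t. 0 \<le> t \<and> p t * q t > 0} = 0" using cond by auto
    have "a * b \<ge> 0"
    proof (rule ccontr)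
      assume "\<not> a * b \<ge> 0"
      then have "\<forall>\<^sub>F t in at_right 0. p t * q t / t ^ (k + j) < 0"
        using leading_term_mult[OF p(2) q(2)] unfolding leading_term_def
        by (intro order_tendstoD(2)[of _ "a * b"]) auto
      then obtain d where d: "d > 0" "\<And>t. 0 < t \<Longrightarrow> t < d \<Longrightarrow> p t * q t / t ^ (k + j) < 0"
        unfolding eventually_at_right_field by auto
      obtain t where t: "0 \<le> t" "p t * q t > 0" "t < d"
        using inf_set_eq_0D[OF inf d(1)] by blast
      then have "t > 0" using assms(10) by (cases "t = 0") auto
      then show False using d(2)[of t] t by (simp add: divide_less_0_iff)
    qed
    then show ?thesis using p q nm by (simp add: less_le)
  qed
  then have ab: "a = b" using agree(2) by (rule power_eq_imp_eq_if_odd_or_same_sign)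
  have "k \<noteq> 0"
  proof
    assume "k = 0"
    then have "leading_term p 0 a" "leading_term p 0 (p 0)"
      using p right_analytic_at_leading_term_0[of p 0] an(1) by (auto simp: right_analytic_def)
    then show False using leading_term_unique assms(10) p(1) by blast
  qed
  then have k: "k \<ge> 1" by simp
  have q': "leading_term q k a" using q agree(1) ab by simp
  show ?thesis
  proof (rule agreement_everywhere)
    fix s :: real
    assume s: "s \<ge> 0" and below: "\<And>x. 0 \<le> x \<Longrightarrow> x < s \<Longrightarrow> p x = q x"
    show "\<exists>d>0. \<forall>t. s \<le> t \<and> t < s + d \<longrightarrow> p t = q t"
    proof (cases "s = 0")
      case True
      then show ?thesis
        using agreement_at_0[OF an(1) tr(1) p(2) an(2) tr(2) q' p(1) nm eq] by simp
    next
      case False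
      then have "s > 0" using s by simp
      then have "odd n \<and> p s \<noteq> 0 \<or> n > 0 \<and> p s * q s > 0"
        using cond nm(2) by (metis gr_zeroI less_nat_zero_code)
      then have nz: "p s \<noteq> 0" and sign: "odd n \<or> n > 0 \<and> p s * q s > 0"
        by auto
      show ?thesis
        by (rule agreement_continues[OF an(1) tr(1) an(2) tr(2) q' p(1) k nm(2) eq s below nz])
           (use power_eq_imp_eq_if_odd_or_same_sign[OF sign] in auto)
    qed
  qed
qed

end
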